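(* Let $\mathbb{F}$ be an algebraically closed field (of arbitrary characteristic), let $G$ be any finite group, and let $V = \mathbb{F}^n$ with $n \geq 1$ be any finite-dimensional faithful $\mathbb{F}G$-module. Let $W$ be any irreducible $\mathbb{F}G$-module. Then there is an integer $m$ with $1 \leq m \leq |G|$ (depending on $W$) such that all of the following statements hold for this $m$: (i) $W$ is isomorphic to an $\mathbb{F}G$-submodule of $\mathrm{Sym}^m(V)$. (ii) For every integer $k \geq 0$, $W$ is isomorphic to an $\mathbb{F}G$-submodule of $\mathrm{Sym}^{m+k|G|}(V)$. (iii) For every integer $k \geq 0$, $W$ is isomorphic to a quotient $\mathbb{F}G$-module of $\mathrm{Sym}^{m+k|G|}(V)$.
   Context: An $\mathbb{F}G$-module is faithful if the corresponding homomorphism $G \to \mathrm{GL}(V)$ is injective. $\mathrm{Sym}^m(V)$ denotes the $m$-th symmetric power of $V$, with the $G$-action induced from $V$: fixing a basis $(x_1,\ldots,x_n)$ of $V$, it is identified with the space of homogeneous polynomials of degree $m$ in the variables $x_1,\ldots,x_n$, where $G$ acts by the algebra automorphisms of $\mathbb{F}[x_1,\ldots,x_n]$ extending its linear action on $V = \langle x_1,\ldots,x_n\rangle_{\mathbb{F}}$. The characteristic of $\mathbb{F}$ is allowed to divide $|G|$. *)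

theory Defs
  imports
    "HOL-Library.Poly_Mapping"
    "HOL-Analysis.Finite_Cartesian_Product"
    "HOL-Algebra.QuotRing"
    "HOL-Algebra.Module"
    "HOL-Algebra.Algebraic_Closure_Type"
begin

hide_const (open) Multiset.mult Polynomial.smult Polynomial.order Modules.module

section \<open>Modules for a group over a field\<close>

text \<open>
  The coefficient field is a type \<open>'f\<close> of class \<^class>\<open>field\<close>, viewed as a ring of HOL-Algebra
  through \<^const>\<open>ring_of_type_algebra\<close>. An \<open>FG\<close>-module is a vector space over it, together with a
  linear action of \<open>G\<close>. The fields \<open>mult\<close> and \<open>one\<close> inherited from the ring record carry no
  meaning.
\<close>

record ('f, 'v, 'g) gmodule = "('f, 'v) module" +
  act :: "'g \<Rightarrow> 'v \<Rightarrow> 'v"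

locale FG_module = group G + module "ring_of_type_algebra :: 'f::field ring" M
  for G :: "('g, 'r) monoid_scheme" and M :: "('f::field, 'v, 'g) gmodule" +
  assumes act_closed: "\<lbrakk>g \<in> carrier G; x \<in> carrier M\<rbrakk> \<Longrightarrow> act M g x \<in> carrier M"
    and act_add: "\<lbrakk>g \<in> carrier G; x \<in> carrier M; y \<in> carrier M\<rbrakk>
      \<Longrightarrow> act M g (x \<oplus>\<^bsub>M\<^esub> y) = act M g x \<oplus>\<^bsub>M\<^esub> act M g y"
    and act_smult: "\<lbrakk>g \<in> carrier G; x \<in> carrier M\<rbrakk>
      \<Longrightarrow> act M g (c \<odot>\<^bsub>M\<^esub> x) = c \<odot>\<^bsub>M\<^esub> act M g x"
    and act_one: "x \<in> carrier M \<Longrightarrow> act M \<one>\<^bsub>G\<^esub> x = x"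
    and act_mult: "\<lbrakk>g \<in> carrier G; h \<in> carrier G; x \<in> carrier M\<rbrakk>
      \<Longrightarrow> act M (g \<otimes>\<^bsub>G\<^esub> h) x = act M g (act M h x)"

definition FG_faithful :: "('g, 'r) monoid_scheme \<Rightarrow> ('f, 'v, 'g) gmodule \<Rightarrow> bool" where
  "FG_faithful G M \<longleftrightarrow> inj_on (\<lambda>g. restrict (act M g) (carrier M)) (carrier G)"

definition FG_submodule ::
    "'v set \<Rightarrow> ('g, 'r) monoid_scheme \<Rightarrow> ('f::field, 'v, 'g) gmodule \<Rightarrow> bool" where
  "FG_submodule N G M \<longleftrightarrow>
     Module.submodule N (ring_of_type_algebra :: 'f ring) M \<and>
     (\<forall>g\<in>carrier G. \<forall>x\<in>N. act M g x \<in> N)"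

definition FG_irreducible ::
    "('g, 'r) monoid_scheme \<Rightarrow> ('f::field, 'v, 'g) gmodule \<Rightarrow> bool" where
  "FG_irreducible G M \<longleftrightarrow>
     carrier M \<noteq> {\<zero>\<^bsub>M\<^esub>} \<and>
     (\<forall>N. FG_submodule N G M \<longrightarrow> N = {\<zero>\<^bsub>M\<^esub>} \<or> N = carrier M)"

definition FG_hom ::
    "('g, 'r) monoid_scheme \<Rightarrow> ('f, 'v, 'g) gmodule \<Rightarrow> ('f, 'w, 'g) gmodule \<Rightarrow> ('v \<Rightarrow> 'w) set" where
  "FG_hom G M N = {\<phi> \<in> carrier M \<rightarrow> carrier N.
     (\<forall>x\<in>carrier M. \<forall>y\<in>carrier M. \<phi> (x \<oplus>\<^bsub>M\<^esub> y) = \<phi> x \<oplus>\<^bsub>N\<^esub> \<phi> y) \<and>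
     (\<forall>c. \<forall>x\<in>carrier M. \<phi> (c \<odot>\<^bsub>M\<^esub> x) = c \<odot>\<^bsub>N\<^esub> \<phi> x) \<and>
     (\<forall>g\<in>carrier G. \<forall>x\<in>carrier M. \<phi> (act M g x) = act N g (\<phi> x))}"

definition FG_isomorphic ::
    "('g, 'r) monoid_scheme \<Rightarrow> ('f, 'v, 'g) gmodule \<Rightarrow> ('f, 'w, 'g) gmodule \<Rightarrow> bool" where
  "FG_isomorphic G M N \<longleftrightarrow> (\<exists>\<phi>\<in>FG_hom G M N. bij_betw \<phi> (carrier M) (carrier N))"

text \<open>
  The quotient module lives on the cosets of \<open>N\<close>. Its operations are written in the style of
  \<^const>\<open>rcoset_mult\<close>: they collect the cosets of the results over all representatives.
\<close>

definition FG_quotient ::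
    "('f, 'v, 'g) gmodule \<Rightarrow> 'v set \<Rightarrow> ('f, 'v set, 'g) gmodule" where
  "FG_quotient M N =
     \<lparr>carrier = a_rcosets\<^bsub>M\<^esub> N, mult = undefined, one = undefined,
      zero = N, add = set_add M,
      smult = (\<lambda>c B. \<Union>x\<in>B. N +>\<^bsub>M\<^esub> (c \<odot>\<^bsub>M\<^esub> x)),
      act = (\<lambda>g B. \<Union>x\<in>B. N +>\<^bsub>M\<^esub> act M g x)\<rparr>"

definition coord_module :: "('g \<Rightarrow> 'f::field ^ 'n \<Rightarrow> 'f ^ 'n) \<Rightarrow> ('f, 'f ^ 'n, 'g) gmodule" where
  "coord_module \<rho> =
     \<lparr>carrier = UNIV, mult = undefined, one = undefined, zero = 0, add = (+),
      smult = (*s), act = \<rho>\<rparr>"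


section \<open>Polynomials and symmetric powers\<close>

text \<open>
  A polynomial maps exponent vectors to coefficients; the type is a commutative ring under the
  convolution product of \<^theory>\<open>HOL-Library.Poly_Mapping\<close>.
\<close>

type_synonym ('n, 'f) mpoly = "('n \<Rightarrow>\<^sub>0 nat) \<Rightarrow>\<^sub>0 'f"

definition mconst :: "'f::field \<Rightarrow> ('n, 'f) mpoly" where
  "mconst c = Poly_Mapping.single 0 c"

definition mvar :: "'n \<Rightarrow> ('n, 'f::field) mpoly" where
  "mvar i = Poly_Mapping.single (Poly_Mapping.single i 1) 1"

definition msubst :: "('n::finite \<Rightarrow> ('n, 'f::field) mpoly) \<Rightarrow> ('n, 'f) mpoly \<Rightarrow> ('n, 'f) mpoly" where
  "msubst q p = (\<Sum>t\<in>Poly_Mapping.keys p.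
     mconst (Poly_Mapping.lookup p t) * (\<Prod>i\<in>UNIV. q i ^ Poly_Mapping.lookup t i))"

definition homogeneous :: "nat \<Rightarrow> ('n::finite, 'f::field) mpoly \<Rightarrow> bool" where
  "homogeneous m p \<longleftrightarrow>
     (\<forall>t\<in>Poly_Mapping.keys p. (\<Sum>i\<in>UNIV. Poly_Mapping.lookup t i) = m)"

text \<open>The standard basis vector \<open>axis i 1\<close> of \<open>F\<^sup>n\<close> is identified with the variable \<open>x\<^sub>i\<close>.\<close>

definition linear_form :: "'f::field ^ 'n \<Rightarrow> ('n::finite, 'f) mpoly" where
  "linear_form v = (\<Sum>i\<in>UNIV. mconst (v $ i) * mvar i)"

definition poly_act ::
    "('g \<Rightarrow> 'f::field ^ 'n \<Rightarrow> 'f ^ 'n) \<Rightarrow> 'g \<Rightarrow> ('n::finite, 'f) mpoly \<Rightarrow> ('n, 'f) mpoly" where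
  "poly_act \<rho> g = msubst (\<lambda>i. linear_form (\<rho> g (axis i 1)))"

definition Sym_power ::
    "nat \<Rightarrow> ('g \<Rightarrow> 'f::field ^ 'n \<Rightarrow> 'f ^ 'n) \<Rightarrow> ('f, ('n::finite, 'f) mpoly, 'g) gmodule" where
  "Sym_power m \<rho> =
     \<lparr>carrier = {p. homogeneous m p}, mult = undefined, one = undefined, zero = 0, add = (+),
      smult = (\<lambda>c p. mconst c * p), act = poly_act \<rho>\<rparr>"

end

theory Submission
  imports Defs
begin

text \<open>
  Choose a linear functional \<open>\<alpha>\<close> on \<open>V\<close> such that \<open>\<alpha> \<circ> g\<close> is proportional to \<open>\<alpha>\<close> only for the \<open>g\<close>
  that act as scalars, and let \<open>Z\<close> be the subgroup of those \<open>g\<close>. For \<open>m \<ge> |G| - |Z|\<close>, a product of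
  linear forms gives \<open>h \<in> Sym\<^sup>m(V)\<close> with \<open>h(\<alpha> \<circ> g) = 0\<close> for \<open>g \<notin> Z\<close> and \<open>h(\<alpha>) = 1\<close>. Evaluation along
  the orbit of \<open>\<alpha>\<close> yields a homomorphism \<open>\<psi> p = \<Sum>\<^sub>g p(\<alpha> \<circ> g\<^sup>-\<^sup>1) g w\<close> from \<open>Sym\<^sup>m(V)\<close> to \<open>W\<close>, and a
  linear functional \<open>\<theta>\<close> on \<open>W\<close> yields a homomorphism \<open>\<Phi> u = \<Sum>\<^sub>g \<theta>(g\<^sup>-\<^sup>1 u) g h\<close> from \<open>W\<close> to
  \<open>Sym\<^sup>m(V)\<close>, with \<open>(\<Phi> w)(\<alpha>) = \<theta>(\<psi> h)\<close>. So both are nonzero for suitable \<open>\<theta>\<close> as soon as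
  \<open>\<psi> h = \<Sum>\<^bsub>z\<in>Z\<^esub> \<mu>(z)\<^sup>m z w \<noteq> 0\<close>, where \<open>\<mu>(z)\<close> is the scalar by which \<open>z\<^sup>-\<^sup>1\<close> acts on \<open>V\<close>. As \<open>V\<close> is
  faithful, \<open>\<mu>\<close> is injective on \<open>Z\<close>, and a Vandermonde argument shows that this holds for some \<open>m\<close>
  among any \<open>|Z|\<close> consecutive integers. Moreover \<open>\<mu>(z)\<^sup>m\<close> depends only on \<open>m\<close> modulo \<open>|G|\<close>.
\<close>

section \<open>Substitution into polynomials\<close>

text \<open>The coefficient map \<phi> is left open so that one theory covers both substitution of
  polynomials (\<open>mconst\<close>) and evaluation at points of the field (the identity).\<close>

definition poly_eval ::
    "('f \<Rightarrow> 'r) \<Rightarrow> ('n \<Rightarrow> 'r) \<Rightarrow> ('n::finite, 'f::field) mpoly \<Rightarrow> 'r::comm_ring_1" where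
  "poly_eval \<phi> a p = (\<Sum>t\<in>Poly_Mapping.keys p.
     \<phi> (Poly_Mapping.lookup p t) * (\<Prod>i\<in>UNIV. a i ^ Poly_Mapping.lookup t i))"

lemma msubst_eq_poly_eval: "msubst = poly_eval mconst"
  by (simp add: fun_eq_iff msubst_def poly_eval_def)

locale coeff_hom =
  fixes \<phi> :: "'f::field \<Rightarrow> 'r::comm_ring_1"
  assumes add: "\<phi> (x + y) = \<phi> x + \<phi> y"
    and mult: "\<phi> (x * y) = \<phi> x * \<phi> y"
    and one: "\<phi> 1 = 1"
begin

text \<open>Not a simplification rule: for \<open>\<phi> = (\<lambda>c. c)\<close> it rewrites \<open>0\<close> to itself.\<close>

lemma zero: "\<phi> 0 = 0"
  using add[of 0 0] by simp

lemma sum: "\<phi> (\<Sum>x\<in>I. f x) = (\<Sum>x\<in>I. \<phi> (f x))"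
  by (induction I rule: infinite_finite_induct) (simp_all add: add zero)

text \<open>Enlarging the index set only adds terms with coefficient \<open>\<phi> 0 = 0\<close>;
  polynomials with different supports can thus be summed over one common set.\<close>

lemma poly_eval_superset:
  assumes "finite K" "Poly_Mapping.keys p \<subseteq> K"
  shows "poly_eval \<phi> a p = (\<Sum>t\<in>K.
     \<phi> (Poly_Mapping.lookup p t) * (\<Prod>i\<in>UNIV. a i ^ Poly_Mapping.lookup t i))"
  unfolding poly_eval_def
  using assms by (intro sum.mono_neutral_left) (auto simp: in_keys_iff zero)

lemma poly_eval_zero [simp]: "poly_eval \<phi> a 0 = 0"
  by (simp add: poly_eval_def)

lemma poly_eval_add: "poly_eval \<phi> a (p + q) = poly_eval \<phi> a p + poly_eval \<phi> a q"
proof -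
  define K where "K = Poly_Mapping.keys p \<union> Poly_Mapping.keys q"
  have K: "finite K" "Poly_Mapping.keys p \<subseteq> K" "Poly_Mapping.keys q \<subseteq> K"
      "Poly_Mapping.keys (p + q) \<subseteq> K"
    using keys_add[of p q] by (auto simp: K_def)
  then show ?thesis
    by (simp add: poly_eval_superset[of K] lookup_add add ring_distribs sum.distrib)
qed

lemma poly_eval_sum: "poly_eval \<phi> a (\<Sum>x\<in>I. f x) = (\<Sum>x\<in>I. poly_eval \<phi> a (f x))"
  by (induction I rule: infinite_finite_induct) (simp_all add: poly_eval_add)

lemma poly_eval_single:
  "poly_eval \<phi> a (Poly_Mapping.single t c) = \<phi> c * (\<Prod>i\<in>UNIV. a i ^ Poly_Mapping.lookup t i)"
  by (simp add: poly_eval_def zero)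

lemma poly_eval_mconst [simp]: "poly_eval \<phi> a (mconst c) = \<phi> c"
  by (simp add: mconst_def poly_eval_single)

lemma poly_eval_mvar [simp]: "poly_eval \<phi> a (mvar i) = a i"
proof -
  have "(\<Prod>j\<in>UNIV. a j ^ Poly_Mapping.lookup (Poly_Mapping.single i (1::nat)) j)
      = (\<Prod>j\<in>UNIV. if i = j then a j else 1)"
    by (intro prod.cong) (auto simp: lookup_single when_def)
  then show ?thesis
    by (simp add: mvar_def poly_eval_single one)
qed

end

text \<open>Reduces claims that are additive in p to single monomials.\<close>

lemma poly_mapping_induct [case_names zero single add]:
  assumes "P 0" "\<And>t c. P (Poly_Mapping.single t c)" "\<And>p q. P p \<Longrightarrow> P q \<Longrightarrow> P (p + q)"
  shows "P p"
proof (induction p rule: update_induct)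
  case (update f a b)
  have "Poly_Mapping.update a b f = Poly_Mapping.single a b + f"
    using update(1) by (intro poly_mapping_eqI)
      (auto simp: lookup_update lookup_add lookup_single in_keys_iff when_def)
  then show ?case
    using assms update by simp
qed (fact assms)

context coeff_hom
begin

text \<open>Both sides are biadditive, so two inductions leave only a product of monomials, where
  exponents add.\<close>

lemma poly_eval_mult: "poly_eval \<phi> a (p * q) = poly_eval \<phi> a p * poly_eval \<phi> a q"
proof (induction p rule: poly_mapping_induct)
  case (single s c)
  show ?case
  proof (induction q rule: poly_mapping_induct)
    case (single t d)
    show ?case
      by (simp add: mult_single poly_eval_single mult lookup_add power_add prod.distrib)
  qed (simp_all add: poly_eval_add ring_distribs)
qed (simp_all add: poly_eval_add ring_distribs)

lemma poly_eval_one [simp]: "poly_eval \<phi> a 1 = 1"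
  using poly_eval_mconst[of a 1] by (simp add: mconst_def one del: poly_eval_mconst)

lemma poly_eval_prod: "poly_eval \<phi> a (\<Prod>x\<in>I. f x) = (\<Prod>x\<in>I. poly_eval \<phi> a (f x))"
  by (induction I rule: infinite_finite_induct) (simp_all add: poly_eval_mult)

lemma poly_eval_power: "poly_eval \<phi> a (p ^ n) = poly_eval \<phi> a p ^ n"
  by (induction n) (simp_all add: poly_eval_mult)

end

interpretation mconst: coeff_hom mconst
  by unfold_locales (simp_all add: mconst_def single_add mult_single)

interpretation id: coeff_hom "\<lambda>c. c"
  by unfold_locales simp_all

context coeff_hom
begin

lemma poly_eval_msubst: "poly_eval \<phi> a (msubst q p) = poly_eval \<phi> (\<lambda>i. poly_eval \<phi> a (q i)) p"
  by (simp add: msubst_def poly_eval_sum poly_eval_mult poly_eval_prod poly_eval_power)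
    (simp add: poly_eval_def)

lemma poly_eval_linear_form: "poly_eval \<phi> a (linear_form v) = (\<Sum>i\<in>UNIV. \<phi> (v $ i) * a i)"
  by (simp add: linear_form_def poly_eval_sum poly_eval_mult)

end

lemma msubst_mvar:
  fixes p :: "('n::finite, 'f::field) mpoly"
  shows "msubst mvar p = p"
proof (induction p rule: poly_mapping_induct)
  case (single t c)
  have *: "mvar i ^ k = Poly_Mapping.single (Poly_Mapping.single i k) (1::'f)" for i :: 'n and k
    by (induction k) (simp_all add: mvar_def mult_single flip: single_add)
  have **: "(\<Prod>i\<in>I. Poly_Mapping.single (f i) (1::'f)) = Poly_Mapping.single (\<Sum>i\<in>I. f i) 1"
    for I and f :: "'n \<Rightarrow> ('n \<Rightarrow>\<^sub>0 nat)"
    by (induction I rule: infinite_finite_induct) (simp_all add: mult_single)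
  have ***: "(\<Sum>i\<in>UNIV. Poly_Mapping.single i (Poly_Mapping.lookup t i)) = t"
    by (intro poly_mapping_eqI) (simp add: lookup_sum lookup_single when_def)
  show ?case
    by (simp add: msubst_eq_poly_eval mconst.poly_eval_single * ** ***)
      (simp add: mconst_def mult_single)
qed (simp_all add: msubst_eq_poly_eval mconst.poly_eval_add)

lemma linear_form_axis: "linear_form (axis i (1::'f::field)) = mvar i"
proof -
  have "linear_form (axis i (1::'f)) = (\<Sum>j\<in>UNIV. if i = j then mvar j else 0)"
    unfolding linear_form_def by (intro sum.cong) (auto simp: axis_def mconst.one mconst.zero)
  then show ?thesis
    by simp
qed

subsection \<open>Homogeneous polynomials\<close>

lemma homogeneous_zero [simp]: "homogeneous m 0"
  by (simp add: homogeneous_def)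

lemma homogeneous_add: "homogeneous m p \<Longrightarrow> homogeneous m q \<Longrightarrow> homogeneous m (p + q)"
  using keys_add[of p q] by (auto simp: homogeneous_def)

lemma homogeneous_sum: "(\<And>x. x \<in> I \<Longrightarrow> homogeneous m (f x)) \<Longrightarrow> homogeneous m (\<Sum>x\<in>I. f x)"
  by (induction I rule: infinite_finite_induct) (simp_all add: homogeneous_add)

lemma homogeneous_mult: "homogeneous m p \<Longrightarrow> homogeneous n q \<Longrightarrow> homogeneous (m + n) (p * q)"
  using keys_mult[of p q] by (fastforce simp: homogeneous_def lookup_add sum.distrib)

lemma homogeneous_mconst [simp]: "homogeneous 0 (mconst c)"
  by (auto simp: homogeneous_def mconst_def)

lemma homogeneous_mconst_mult: "homogeneous m p \<Longrightarrow> homogeneous m (mconst c * p)"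
  using homogeneous_mult[of 0 "mconst c" m p] by simp

lemma homogeneous_one [simp]: "homogeneous 0 1"
  using homogeneous_mconst[of 1] by (simp add: mconst.one)

lemma homogeneous_prod:
  "(\<And>x. x \<in> I \<Longrightarrow> homogeneous (d x) (f x)) \<Longrightarrow> homogeneous (\<Sum>x\<in>I. d x) (\<Prod>x\<in>I. f x)"
  by (induction I rule: infinite_finite_induct) (simp_all add: homogeneous_mult)

lemma homogeneous_power: "homogeneous d p \<Longrightarrow> homogeneous (k * d) (p ^ k)"
  by (induction k) (simp_all add: homogeneous_mult)

lemma homogeneous_mvar: "homogeneous 1 (mvar i)"
proof -
  have "(\<Sum>j\<in>UNIV. Poly_Mapping.lookup (Poly_Mapping.single i (1::nat)) j)
      = (\<Sum>j\<in>UNIV. if i = j then 1 else 0)"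
    by (intro sum.cong) (auto simp: lookup_single when_def)
  then show ?thesis
    by (simp add: homogeneous_def mvar_def)
qed

lemma homogeneous_linear_form: "homogeneous 1 (linear_form v)"
  unfolding linear_form_def
  by (intro homogeneous_sum homogeneous_mconst_mult homogeneous_mvar)

lemma homogeneous_msubst:
  assumes "homogeneous m p" "\<And>i. homogeneous 1 (q i)"
  shows "homogeneous m (msubst q p)"
  unfolding msubst_def
proof (intro homogeneous_sum homogeneous_mconst_mult)
  fix t assume "t \<in> Poly_Mapping.keys p"
  \<comment> \<open>The factor 1 is the degree of each \<open>q i\<close>; it brings m into the
    shape that the product and power rules produce.\<close>
  then have "m = (\<Sum>i\<in>UNIV. Poly_Mapping.lookup t i * 1)"
    using assms(1) by (simp add: homogeneous_def)
  then show "homogeneous m (\<Prod>i\<in>UNIV. q i ^ Poly_Mapping.lookup t i)"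
    by (simp only:) (intro homogeneous_prod homogeneous_power assms(2))
qed

text \<open>This is the source of the factor \<open>\<mu> g ^ m\<close> at those points of the orbit
  that are multiples of \<alpha>.\<close>

lemma poly_eval_scale:
  assumes "homogeneous m p"
  shows "poly_eval (\<lambda>c. c) (\<lambda>i. c * a i) p = c ^ m * poly_eval (\<lambda>c. c) a p"
proof -
  have "(\<Prod>i\<in>UNIV. (c * a i) ^ Poly_Mapping.lookup t i)
      = c ^ m * (\<Prod>i\<in>UNIV. a i ^ Poly_Mapping.lookup t i)" if "t \<in> Poly_Mapping.keys p" for t
    using that assms by (simp add: power_mult_distrib prod.distrib homogeneous_def flip: power_sum)
  then show ?thesis
    by (simp add: poly_eval_def sum_distrib_left mult_ac)
qed

section \<open>Symmetric powers as modules\<close>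

lemma ring_of_type_algebra_simps [simp]:
  "carrier ring_of_type_algebra = UNIV"
  "x \<oplus>\<^bsub>ring_of_type_algebra\<^esub> y = x + y"
  "x \<otimes>\<^bsub>ring_of_type_algebra\<^esub> y = x * y"
  "\<zero>\<^bsub>ring_of_type_algebra\<^esub> = 0"
  "\<one>\<^bsub>ring_of_type_algebra\<^esub> = 1"
  by (simp_all add: ring_of_type_algebra_def)

lemma coord_module_simps [simp]:
  "carrier (coord_module \<rho>) = UNIV" "x \<oplus>\<^bsub>coord_module \<rho>\<^esub> y = x + y"
  "c \<odot>\<^bsub>coord_module \<rho>\<^esub> x = c *s x" "\<zero>\<^bsub>coord_module \<rho>\<^esub> = 0" "act (coord_module \<rho>) = \<rho>"
  by (simp_all add: coord_module_def)

lemma Sym_power_simps [simp]: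
  "carrier (Sym_power m \<rho>) = {p. homogeneous m p}" "p \<oplus>\<^bsub>Sym_power m \<rho>\<^esub> q = p + q"
  "c \<odot>\<^bsub>Sym_power m \<rho>\<^esub> p = mconst c * p" "\<zero>\<^bsub>Sym_power m \<rho>\<^esub> = 0"
  "act (Sym_power m \<rho>) = poly_act \<rho>"
  by (simp_all add: Sym_power_def)

lemma poly_act_eq_poly_eval:
  "poly_act \<rho> g = poly_eval mconst (\<lambda>i. linear_form (\<rho> g (axis i 1)))"
  by (simp add: poly_act_def msubst_eq_poly_eval)

lemma homogeneous_poly_act: "homogeneous m p \<Longrightarrow> homogeneous m (poly_act \<rho> g p)"
  unfolding poly_act_def by (intro homogeneous_msubst homogeneous_linear_form)

locale coord_rep =
  fixes G :: "('g, 'r) monoid_scheme" and \<rho> :: "'g \<Rightarrow> 'f::field ^ 'n::finite \<Rightarrow> 'f ^ 'n"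
  assumes rep: "FG_module G (coord_module \<rho>)"
begin

sublocale V: FG_module G "coord_module \<rho>"
  by (fact rep)

lemma rep_add: "g \<in> carrier G \<Longrightarrow> \<rho> g (x + y) = \<rho> g x + \<rho> g y"
  using V.act_add[of g x y] by simp

lemma rep_scale: "g \<in> carrier G \<Longrightarrow> \<rho> g (c *s x) = c *s \<rho> g x"
  using V.act_smult[of g x c] by simp

lemma rep_one: "\<rho> \<one>\<^bsub>G\<^esub> x = x"
  using V.act_one[of x] by simp

lemma rep_mult: "g \<in> carrier G \<Longrightarrow> h \<in> carrier G \<Longrightarrow> \<rho> (g \<otimes>\<^bsub>G\<^esub> h) x = \<rho> g (\<rho> h x)"
  using V.act_mult[of g h x] by simp

lemma rep_expand:
  assumes "g \<in> carrier G"
  shows "\<rho> g v = (\<Sum>j\<in>UNIV. v $ j *s \<rho> g (axis j 1))"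
proof -
  have zero: "\<rho> g 0 = 0"
    using rep_add[OF assms, of 0 0] by simp
  have sum: "\<rho> g (\<Sum>j\<in>J. f j) = (\<Sum>j\<in>J. \<rho> g (f j))" for J :: "'n set" and f
    by (induction J rule: infinite_finite_induct) (simp_all add: zero rep_add[OF assms])
  have "v = (\<Sum>j\<in>UNIV. v $ j *s axis j 1)"
    by (simp add: vec_eq_iff axis_def if_distrib[of "\<lambda>x. _ * x"] cong: if_cong)
  from arg_cong[OF this, of "\<rho> g"] show ?thesis
    by (simp add: sum rep_scale[OF assms])
qed

lemma poly_act_one: "poly_act \<rho> \<one>\<^bsub>G\<^esub> p = p"
  by (simp add: poly_act_def rep_one linear_form_axis msubst_mvar)

lemma poly_act_mult:
  assumes "g \<in> carrier G" "h \<in> carrier G"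
  shows "poly_act \<rho> (g \<otimes>\<^bsub>G\<^esub> h) p = poly_act \<rho> g (poly_act \<rho> h p)"
proof -
  \<comment> \<open>The case of degree one: g applied to a linear form is the substitution of the
    images of the variables. The general case follows by composing substitutions.\<close>
  have lin: "linear_form (\<rho> g v) = (\<Sum>j\<in>UNIV. mconst (v $ j) * linear_form (\<rho> g (axis j 1)))"
    for v
  proof -
    have "linear_form (\<rho> g v)
        = (\<Sum>i\<in>UNIV. \<Sum>j\<in>UNIV. mconst (v $ j) * (mconst (\<rho> g (axis j 1) $ i) * mvar i))"
      by (subst rep_expand[OF assms(1)])
        (simp add: linear_form_def mconst.mult sum_distrib_right mult.assoc
          mconst.sum)
    also have "\<dots> = (\<Sum>j\<in>UNIV. mconst (v $ j) * linear_form (\<rho> g (axis j 1)))"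
      by (subst sum.swap) (simp add: linear_form_def sum_distrib_left)
    finally show ?thesis .
  qed
  have "poly_act \<rho> g (poly_act \<rho> h p)
      = poly_eval mconst (\<lambda>i. poly_eval mconst (\<lambda>j. linear_form (\<rho> g (axis j 1)))
          (linear_form (\<rho> h (axis i 1)))) p"
    unfolding poly_act_eq_poly_eval mconst.poly_eval_msubst[symmetric] msubst_eq_poly_eval ..
  also have "\<dots> = poly_act \<rho> (g \<otimes>\<^bsub>G\<^esub> h) p"
    by (simp only: mconst.poly_eval_linear_form lin[symmetric] rep_mult[OF assms, symmetric]
        poly_act_eq_poly_eval)
  finally show ?thesis ..
qed

lemma Sym_power_FG_module: "FG_module G (Sym_power m \<rho>)"
proof -
  have "abelian_group (Sym_power m \<rho>)"
  proof (rule abelian_groupI)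
    fix x assume "x \<in> carrier (Sym_power m \<rho>)"
    then have "homogeneous m (mconst (- 1) * x)"
      by (simp add: homogeneous_mconst_mult)
    moreover have "mconst (- 1) * x + x = (mconst (- 1 + 1)) * x"
      unfolding mconst.add by (simp add: mconst.one ring_distribs)
    ultimately show "\<exists>y\<in>carrier (Sym_power m \<rho>). y \<oplus>\<^bsub>Sym_power m \<rho>\<^esub> x = \<zero>\<^bsub>Sym_power m \<rho>\<^esub>"
      by (auto simp: mconst.zero)
  qed (simp_all add: homogeneous_add add_ac)
  then have "module (ring_of_type_algebra :: 'f ring) (Sym_power m \<rho>)"
    by (intro moduleI cring_from_type_algebra)
      (simp_all add: homogeneous_mconst_mult mconst.add mconst.mult mconst.one ring_distribs
        mult.assoc)
  then show ?thesis
    by (intro FG_module.intro V.is_group FG_module_axioms.intro)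
      (simp_all add: homogeneous_poly_act poly_act_one poly_act_mult,
       simp_all add: poly_act_eq_poly_eval mconst.poly_eval_add mconst.poly_eval_mult)
qed

end

lemma (in group) inv_mult_cancel:
  assumes "x \<in> carrier G" "y \<in> carrier G"
  shows "inv x \<otimes> (x \<otimes> y) = y" "x \<otimes> (inv x \<otimes> y) = y"
    "inv (x \<otimes> y) \<otimes> x = inv y"
  using assms by (simp_all add: inv_mult_group flip: m_assoc) (simp add: m_assoc)

section \<open>Homomorphisms from and to irreducible modules\<close>

context FG_module
begin

lemma smult_add: "x \<in> carrier M \<Longrightarrow> (a + b) \<odot>\<^bsub>M\<^esub> x = a \<odot>\<^bsub>M\<^esub> x \<oplus>\<^bsub>M\<^esub> b \<odot>\<^bsub>M\<^esub> x"
  using smult_l_distr[of a b x] by simp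

lemma smult_mult: "x \<in> carrier M \<Longrightarrow> (a * b) \<odot>\<^bsub>M\<^esub> x = a \<odot>\<^bsub>M\<^esub> (b \<odot>\<^bsub>M\<^esub> x)"
  using smult_assoc1[of a b x] by simp

lemma smult_zero: "x \<in> carrier M \<Longrightarrow> 0 \<odot>\<^bsub>M\<^esub> x = \<zero>\<^bsub>M\<^esub>"
  using smult_l_null[of x] by simp

lemma smult_1: "x \<in> carrier M \<Longrightarrow> 1 \<odot>\<^bsub>M\<^esub> x = x"
  using smult_one[of x] by simp

text \<open>Closure under negation follows from closure under scalars, as -x is (-1)x.\<close>

lemma FG_submoduleI:
  assumes "N \<subseteq> carrier M" "\<zero>\<^bsub>M\<^esub> \<in> N"
    and "\<And>x y. x \<in> N \<Longrightarrow> y \<in> N \<Longrightarrow> x \<oplus>\<^bsub>M\<^esub> y \<in> N"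
    and smult: "\<And>c x. x \<in> N \<Longrightarrow> c \<odot>\<^bsub>M\<^esub> x \<in> N"
    and "\<And>g x. g \<in> carrier G \<Longrightarrow> x \<in> N \<Longrightarrow> act M g x \<in> N"
  shows "FG_submodule N G M"
  unfolding FG_submodule_def
proof (intro conjI submoduleI ballI)
  fix x assume x: "x \<in> N"
  then have "x \<in> carrier M"
    using assms(1) by auto
  then have "(- 1) \<odot>\<^bsub>M\<^esub> x = \<ominus>\<^bsub>M\<^esub> x"
    using smult_add[of x "- 1" 1] by (intro M.minus_equality[symmetric])
      (simp_all add: smult_zero smult_1)
  then show "\<ominus>\<^bsub>M\<^esub> x \<in> N"
    using smult[OF x] by metis
qed (use assms in auto)

lemma act_zero: "g \<in> carrier G \<Longrightarrow> act M g \<zero>\<^bsub>M\<^esub> = \<zero>\<^bsub>M\<^esub>"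
  using act_smult[of g "\<zero>\<^bsub>M\<^esub>" 0] act_closed[of g "\<zero>\<^bsub>M\<^esub>"] smult_l_null by simp

end

section \<open>Kernels, images, Schur-type arguments and the first isomorphism theorem\<close>

locale FG_module_hom = M: FG_module G M + N: FG_module G N
  for G :: "('g, 'r) monoid_scheme" and M :: "('f::field, 'v, 'g) gmodule"
    and N :: "('f, 'w, 'g) gmodule" +
  fixes \<phi> :: "'v \<Rightarrow> 'w"
  assumes hom: "\<phi> \<in> FG_hom G M N"
begin

lemma hom_closed: "x \<in> carrier M \<Longrightarrow> \<phi> x \<in> carrier N"
  and hom_add: "x \<in> carrier M \<Longrightarrow> y \<in> carrier M \<Longrightarrow> \<phi> (x \<oplus>\<^bsub>M\<^esub> y) = \<phi> x \<oplus>\<^bsub>N\<^esub> \<phi> y"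
  and hom_smult: "x \<in> carrier M \<Longrightarrow> \<phi> (c \<odot>\<^bsub>M\<^esub> x) = c \<odot>\<^bsub>N\<^esub> \<phi> x"
  and hom_act: "g \<in> carrier G \<Longrightarrow> x \<in> carrier M \<Longrightarrow> \<phi> (act M g x) = act N g (\<phi> x)"
  using hom by (auto simp: FG_hom_def)

lemma hom_zero: "\<phi> \<zero>\<^bsub>M\<^esub> = \<zero>\<^bsub>N\<^esub>"
  using hom_smult[of "\<zero>\<^bsub>M\<^esub>" 0] by (simp add: M.smult_zero N.smult_zero hom_closed)

lemma hom_minus: "x \<in> carrier M \<Longrightarrow> \<phi> (\<ominus>\<^bsub>M\<^esub> x) = \<ominus>\<^bsub>N\<^esub> \<phi> x"
  using hom_add[of "\<ominus>\<^bsub>M\<^esub> x" x]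
  by (intro N.minus_equality[symmetric]) (simp_all add: hom_closed hom_zero M.M.l_neg)

definition ker :: "'v set" where
  "ker = {x \<in> carrier M. \<phi> x = \<zero>\<^bsub>N\<^esub>}"

lemma ker_submodule: "FG_submodule ker G M"
  by (rule M.FG_submoduleI)
    (auto simp: ker_def hom_add hom_smult hom_act hom_zero M.act_closed N.act_zero)

lemma image_submodule: "FG_submodule (\<phi> ` carrier M) G N"
proof (rule N.FG_submoduleI)
  show "\<zero>\<^bsub>N\<^esub> \<in> \<phi> ` carrier M"
    using hom_zero by (metis M.M.zero_closed imageI)
qed (auto simp: hom_closed simp flip: hom_add hom_smult hom_act intro: M.act_closed)

lemma diff_in_ker:
  assumes "x \<in> carrier M" "y \<in> carrier M" "\<phi> x = \<phi> y"
  shows "x \<oplus>\<^bsub>M\<^esub> \<ominus>\<^bsub>M\<^esub> y \<in> ker"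
  using assms by (simp add: ker_def hom_add hom_minus hom_closed N.M.r_neg)

text \<open>The kernel is a submodule that misses a, so irreducibility makes it zero.\<close>

lemma isomorphic_image:
  assumes "FG_irreducible G M" "a \<in> carrier M" "\<phi> a \<noteq> \<zero>\<^bsub>N\<^esub>"
  shows "FG_isomorphic G M (N\<lparr>carrier := \<phi> ` carrier M\<rparr>)"
proof -
  have ker: "ker = {\<zero>\<^bsub>M\<^esub>}"
    using assms ker_submodule by (auto simp: FG_irreducible_def ker_def)
  have "inj_on \<phi> (carrier M)"
  proof (rule inj_onI)
    fix x y assume xy: "x \<in> carrier M" "y \<in> carrier M" "\<phi> x = \<phi> y"
    then have "x \<oplus>\<^bsub>M\<^esub> \<ominus>\<^bsub>M\<^esub> y = \<zero>\<^bsub>M\<^esub>"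
      using diff_in_ker ker by blast
    then show "x = y"
      using xy by (metis M.M.minus_equality M.M.minus_minus M.M.a_inv_closed)
  qed
  moreover have "\<phi> \<in> FG_hom G M (N\<lparr>carrier := \<phi> ` carrier M\<rparr>)"
    using hom by (auto simp: FG_hom_def)
  ultimately show ?thesis
    by (auto simp: FG_isomorphic_def bij_betw_def)
qed

lemma surj:
  assumes "FG_irreducible G N" "a \<in> carrier M" "\<phi> a \<noteq> \<zero>\<^bsub>N\<^esub>"
  shows "\<phi> ` carrier M = carrier N"
  using assms image_submodule by (auto simp: FG_irreducible_def)

lemma ker_coset:
  assumes "x \<in> carrier M"
  shows "ker +>\<^bsub>M\<^esub> x = {y \<in> carrier M. \<phi> y = \<phi> x}"
proof (intro equalityI subsetI)
  fix y assume y: "y \<in> {y \<in> carrier M. \<phi> y = \<phi> x}"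
  then have "y \<oplus>\<^bsub>M\<^esub> \<ominus>\<^bsub>M\<^esub> x \<in> ker"
    using assms by (intro diff_in_ker) auto
  moreover have "y = (y \<oplus>\<^bsub>M\<^esub> \<ominus>\<^bsub>M\<^esub> x) \<oplus>\<^bsub>M\<^esub> x"
    using assms y by (simp add: M.M.a_assoc M.M.l_neg)
  ultimately show "y \<in> ker +>\<^bsub>M\<^esub> x"
    unfolding a_r_coset_def' by blast
qed (use assms in \<open>auto simp: a_r_coset_def' ker_def hom_add hom_closed\<close>)

lemma isomorphic_quotient:
  assumes "\<phi> ` carrier M = carrier N"
  shows "FG_isomorphic G N (FG_quotient M ker)"
proof -
  \<comment> \<open>The fibre of \<phi> over u, which is a coset of the kernel: the inverse of the
    map that \<phi> induces on the quotient.\<close>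
  define \<psi> where "\<psi> u = {x \<in> carrier M. \<phi> x = u}" for u
  have coset: "ker +>\<^bsub>M\<^esub> x = \<psi> (\<phi> x)" if "x \<in> carrier M" for x
    using ker_coset[OF that] by (simp add: \<psi>_def)
  have ex: "\<exists>x\<in>carrier M. \<phi> x = u" if "u \<in> carrier N" for u
    using that assms by (metis imageE)
  have rcosets: "a_rcosets\<^bsub>M\<^esub> ker = \<psi> ` carrier N"
    unfolding A_RCOSETS_def' assms[symmetric] by (auto simp: coset image_iff)
  have "\<psi> (u \<oplus>\<^bsub>N\<^esub> v) = set_add M (\<psi> u) (\<psi> v)" if uv: "u \<in> carrier N" "v \<in> carrier N" for u v
  proof (intro equalityI subsetI)
    fix y assume y: "y \<in> \<psi> (u \<oplus>\<^bsub>N\<^esub> v)"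
    obtain x where x: "x \<in> carrier M" "\<phi> x = u"
      using ex uv by blast
    have "\<ominus>\<^bsub>M\<^esub> x \<oplus>\<^bsub>M\<^esub> y \<in> \<psi> v" and "y = x \<oplus>\<^bsub>M\<^esub> (\<ominus>\<^bsub>M\<^esub> x \<oplus>\<^bsub>M\<^esub> y)"
      using x y uv by (auto simp: \<psi>_def hom_add hom_minus N.M.r_neg1 N.M.r_neg2 M.M.r_neg2)
    then show "y \<in> set_add M (\<psi> u) (\<psi> v)"
      using x unfolding set_add_def' by (auto simp: \<psi>_def)
  qed (auto simp: set_add_def' \<psi>_def hom_add)
  moreover have "\<psi> (c \<odot>\<^bsub>N\<^esub> u) = (\<Union>x\<in>\<psi> u. ker +>\<^bsub>M\<^esub> (c \<odot>\<^bsub>M\<^esub> x))" if "u \<in> carrier N" for u c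
  proof -
    \<comment> \<open>All representatives give the same coset, so the union in the quotient
      operation runs over a nonempty family of equal sets.\<close>
    have "ker +>\<^bsub>M\<^esub> (c \<odot>\<^bsub>M\<^esub> x) = \<psi> (c \<odot>\<^bsub>N\<^esub> u)" if "x \<in> \<psi> u" for x
      using that by (simp add: coset \<psi>_def hom_smult)
    moreover have "\<psi> u \<noteq> {}"
      using ex[OF that] by (auto simp: \<psi>_def)
    ultimately show ?thesis
      by simp
  qed
  moreover have "\<psi> (act N g u) = (\<Union>x\<in>\<psi> u. ker +>\<^bsub>M\<^esub> act M g x)"
    if "g \<in> carrier G" "u \<in> carrier N" for u g
  proof -
    have "ker +>\<^bsub>M\<^esub> act M g x = \<psi> (act N g u)" if "x \<in> \<psi> u" for x
      using that \<open>g \<in> carrier G\<close> by (simp add: coset \<psi>_def hom_act M.act_closed)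
    moreover have "\<psi> u \<noteq> {}"
      using ex that by (auto simp: \<psi>_def)
    ultimately show ?thesis
      by simp
  qed
  ultimately have "\<psi> \<in> FG_hom G N (FG_quotient M ker)"
    by (simp add: FG_hom_def FG_quotient_def rcosets)
  moreover have "inj_on \<psi> (carrier N)"
    using ex by (auto simp: inj_on_def \<psi>_def)
  ultimately show ?thesis
    by (auto simp: FG_isomorphic_def bij_betw_def FG_quotient_def rcosets)
qed

end

section \<open>The action of the group algebra\<close>

locale finite_FG_module = FG_module G M
  for G :: "('g, 'r) monoid_scheme" and M :: "('f::field, 'v, 'g) gmodule" +
  assumes finite_G: "finite (carrier G)"
begin

text \<open>The group algebra element with coefficients f, applied to w. With w fixed it is linear
  in f, which later yields linearity of \<psi>.\<close>

definition gsum :: "('g \<Rightarrow> 'f) \<Rightarrow> 'v \<Rightarrow> 'v" where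
  "gsum f w = (\<Oplus>\<^bsub>M\<^esub>g\<in>carrier G. f g \<odot>\<^bsub>M\<^esub> act M g w)"

lemma summand_closed:
  "w \<in> carrier M \<Longrightarrow> g \<in> carrier G \<Longrightarrow> f g \<odot>\<^bsub>M\<^esub> act M g w \<in> carrier M"
  by (simp add: act_closed)

lemma gsum_closed: "w \<in> carrier M \<Longrightarrow> gsum f w \<in> carrier M"
  unfolding gsum_def by (intro M.finsum_closed) (auto intro: summand_closed)

lemma gsum_cong:
  assumes "w \<in> carrier M" "\<And>g. g \<in> carrier G \<Longrightarrow> f g = f' g"
  shows "gsum f w = gsum f' w"
  unfolding gsum_def by (rule M.finsum_cong') (auto simp: assms act_closed)

lemma gsum_add:
  assumes "w \<in> carrier M"
  shows "gsum (\<lambda>g. f g + f' g) w = gsum f w \<oplus>\<^bsub>M\<^esub> gsum f' w"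
proof -
  have "gsum (\<lambda>g. f g + f' g) w
      = (\<Oplus>\<^bsub>M\<^esub>g\<in>carrier G. f g \<odot>\<^bsub>M\<^esub> act M g w \<oplus>\<^bsub>M\<^esub> f' g \<odot>\<^bsub>M\<^esub> act M g w)"
    unfolding gsum_def
    by (rule M.finsum_cong') (auto simp: assms act_closed smult_add intro!: summand_closed)
  also have "\<dots> = gsum f w \<oplus>\<^bsub>M\<^esub> gsum f' w"
    unfolding gsum_def by (rule M.finsum_addf) (auto simp: assms act_closed)
  finally show ?thesis .
qed

lemma gsum_smult:
  assumes "w \<in> carrier M"
  shows "gsum (\<lambda>g. c * f g) w = c \<odot>\<^bsub>M\<^esub> gsum f w"
proof -
  have "gsum (\<lambda>g. c * f g) w = (\<Oplus>\<^bsub>M\<^esub>g\<in>carrier G. c \<odot>\<^bsub>M\<^esub> (f g \<odot>\<^bsub>M\<^esub> act M g w))"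
    unfolding gsum_def
    by (rule M.finsum_cong') (auto simp: assms act_closed smult_mult)
  also have "\<dots> = c \<odot>\<^bsub>M\<^esub> gsum f w"
    unfolding gsum_def
    by (rule finsum_smult_ldistr[symmetric]) (auto simp: assms act_closed finite_G)
  finally show ?thesis .
qed

lemma gsum_zero: "w \<in> carrier M \<Longrightarrow> gsum (\<lambda>g. 0) w = \<zero>\<^bsub>M\<^esub>"
  using gsum_smult[of w 0 "\<lambda>g. 0"] by (simp add: smult_zero gsum_closed)

lemma gsum_lincomb_eq_zero:
  assumes "w \<in> carrier M" "\<And>j. j \<in> J \<Longrightarrow> gsum (f j) w = \<zero>\<^bsub>M\<^esub>"
  shows "gsum (\<lambda>g. \<Sum>j\<in>J. c j * f j g) w = \<zero>\<^bsub>M\<^esub>"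
  using assms(2)
  by (induction J rule: infinite_finite_induct) (simp_all add: assms(1) gsum_zero gsum_add gsum_smult)

lemma gsum_delta:
  assumes "w \<in> carrier M"
  shows "gsum (\<lambda>g. if g = \<one>\<^bsub>G\<^esub> then c else 0) w = c \<odot>\<^bsub>M\<^esub> w"
proof -
  have "gsum (\<lambda>g. if g = \<one>\<^bsub>G\<^esub> then c else 0) w
      = (\<Oplus>\<^bsub>M\<^esub>g\<in>carrier G. if \<one>\<^bsub>G\<^esub> = g then c \<odot>\<^bsub>M\<^esub> w else \<zero>\<^bsub>M\<^esub>)"
    unfolding gsum_def
    by (rule M.finsum_cong') (auto simp: assms act_closed act_one smult_zero)
  also have "\<dots> = c \<odot>\<^bsub>M\<^esub> w"
    by (rule M.finsum_singleton) (auto simp: assms finite_G)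
  finally show ?thesis .
qed

lemma act_finsum:
  assumes "h \<in> carrier G" "f \<in> A \<rightarrow> carrier M"
  shows "act M h (finsum M f A) = finsum M (\<lambda>x. act M h (f x)) A"
  using assms(2)
proof (induction A rule: infinite_finite_induct)
  case (insert x A)
  then have "(\<lambda>x. act M h (f x)) \<in> A \<rightarrow> carrier M" "finsum M f A \<in> carrier M"
    using assms(1) by (auto intro!: act_closed)
  then show ?case
    using insert assms(1) by (simp add: act_add act_closed)
qed (simp_all add: act_zero assms(1))

lemma bij_betw_mult_left: "h \<in> carrier G \<Longrightarrow> bij_betw (\<lambda>g. h \<otimes>\<^bsub>G\<^esub> g) (carrier G) (carrier G)"
  by (rule bij_betw_byWitness[where f' = "\<lambda>g. inv\<^bsub>G\<^esub> h \<otimes>\<^bsub>G\<^esub> g"])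
    (auto simp: inv_mult_cancel)

text \<open>Left multiplication by h permutes G, so acting by h only translates the coefficient
  function.\<close>

lemma act_gsum:
  assumes "h \<in> carrier G" "w \<in> carrier M"
  shows "act M h (gsum f w) = gsum (\<lambda>g. f (inv\<^bsub>G\<^esub> h \<otimes>\<^bsub>G\<^esub> g)) w"
proof -
  have img: "(\<lambda>g. h \<otimes>\<^bsub>G\<^esub> g) ` carrier G = carrier G" and inj: "inj_on (\<lambda>g. h \<otimes>\<^bsub>G\<^esub> g) (carrier G)"
    using bij_betw_mult_left[OF assms(1)] by (auto simp: bij_betw_def)
  have "gsum (\<lambda>g. f (inv\<^bsub>G\<^esub> h \<otimes>\<^bsub>G\<^esub> g)) w
      = (\<Oplus>\<^bsub>M\<^esub>g\<in>(\<lambda>g. h \<otimes>\<^bsub>G\<^esub> g) ` carrier G. f (inv\<^bsub>G\<^esub> h \<otimes>\<^bsub>G\<^esub> g) \<odot>\<^bsub>M\<^esub> act M g w)"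
    by (simp add: gsum_def img)
  also have "\<dots> = (\<Oplus>\<^bsub>M\<^esub>g\<in>carrier G.
      f (inv\<^bsub>G\<^esub> h \<otimes>\<^bsub>G\<^esub> (h \<otimes>\<^bsub>G\<^esub> g)) \<odot>\<^bsub>M\<^esub> act M (h \<otimes>\<^bsub>G\<^esub> g) w)"
    by (rule M.finsum_reindex) (auto simp: inj assms act_closed)
  also have "\<dots> = (\<Oplus>\<^bsub>M\<^esub>g\<in>carrier G. act M h (f g \<odot>\<^bsub>M\<^esub> act M g w))"
    using assms
    by (intro M.finsum_cong') (auto simp: act_closed act_smult act_mult inv_mult_cancel)
  also have "\<dots> = act M h (gsum f w)"
    unfolding gsum_def using assms by (intro act_finsum[symmetric]) (auto simp: act_closed)
  finally show ?thesis ..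
qed

lemma functional_gsum:
  assumes add: "\<And>x y. x \<in> carrier M \<Longrightarrow> y \<in> carrier M \<Longrightarrow> \<theta> (x \<oplus>\<^bsub>M\<^esub> y) = \<theta> x + \<theta> y"
    and smult: "\<And>c x. x \<in> carrier M \<Longrightarrow> \<theta> (c \<odot>\<^bsub>M\<^esub> x) = c * \<theta> x"
    and w: "w \<in> carrier M"
  shows "\<theta> (gsum f w) = (\<Sum>g\<in>carrier G. f g * \<theta> (act M g w))"
proof -
  have zero: "\<theta> \<zero>\<^bsub>M\<^esub> = 0"
    using smult[of "\<zero>\<^bsub>M\<^esub>" 0] by (simp add: smult_zero)
  have "\<theta> (finsum M h A) = (\<Sum>x\<in>A. \<theta> (h x))" if "h \<in> A \<rightarrow> carrier M" for h and A :: "'g set"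
    using that
  proof (induction A rule: infinite_finite_induct)
    case (insert x A)
    then have "finsum M h A \<in> carrier M"
      by auto
    then show ?case
      using insert by (simp add: add)
  qed (simp_all add: zero)
  then show ?thesis
    using w by (simp add: gsum_def act_closed smult)
qed

text \<open>Lagrange interpolation on the distinct values of \<open>\<mu>\<close> expresses \<open>w\<close> through the weighted sums.\<close>

lemma exists_weighted_sum_nonzero:
  assumes Z: "Z \<subseteq> carrier G" "\<one>\<^bsub>G\<^esub> \<in> Z" and inj: "inj_on \<mu> Z" and one: "\<mu> \<one>\<^bsub>G\<^esub> = 1"
    and w: "w \<in> carrier M" "w \<noteq> \<zero>\<^bsub>M\<^esub>"
  shows "\<exists>j<card Z. gsum (\<lambda>g. if g \<in> Z then \<mu> g ^ (s + j) else 0) w \<noteq> \<zero>\<^bsub>M\<^esub>"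
proof (rule ccontr)
  assume *: "\<not> ?thesis"
  \<comment> \<open>Up to scale the Lagrange basis polynomial at the node
    \<open>\<mu> \<one> = 1\<close>. Its degree is \<open>card Z - 1\<close>, so
    \<open>card Z\<close> consecutive exponents suffice.\<close>
  define Q where "Q = (\<Prod>z\<in>Z - {\<one>\<^bsub>G\<^esub>}. [:- \<mu> z, 1:])"
  have fin: "finite Z"
    using Z(1) finite_G by (rule finite_subset)
  have "Polynomial.degree Q = card (Z - {\<one>\<^bsub>G\<^esub>})"
    unfolding Q_def by (subst degree_prod_eq_sum_degree) auto
  then have "card Z = Suc (Polynomial.degree Q)"
    using fin Z(2) by (metis card_Suc_Diff1)
  then have Q: "poly Q x = (\<Sum>j<card Z. poly.coeff Q j * x ^ j)" for x
    by (simp add: poly_altdef lessThan_Suc_atMost)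
  have zero: "poly Q (\<mu> g) = 0" if "g \<in> Z" "g \<noteq> \<one>\<^bsub>G\<^esub>" for g
    using that fin by (auto simp: Q_def poly_prod intro!: prod_zero)
  have nz: "poly Q 1 \<noteq> 0"
    using fin inj Z(2) one by (auto simp: Q_def poly_prod inj_on_def)
  \<comment> \<open>Combined with the coefficients of Q, the weights become
    \<open>\<mu> g ^ s * poly Q (\<mu> g)\<close>, which vanish on Z except at the identity. What
    remains is a nonzero multiple of w.\<close>
  have "gsum (\<lambda>g. \<Sum>j\<in>{..<card Z}. poly.coeff Q j * (if g \<in> Z then \<mu> g ^ (s + j) else 0)) w
      = \<zero>\<^bsub>M\<^esub>"
    using * w by (intro gsum_lincomb_eq_zero) auto
  also have "gsum (\<lambda>g. \<Sum>j\<in>{..<card Z}. poly.coeff Q j * (if g \<in> Z then \<mu> g ^ (s + j) else 0)) w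
      = gsum (\<lambda>g. if g = \<one>\<^bsub>G\<^esub> then poly Q 1 else 0) w"
  proof (rule gsum_cong[OF w(1)])
    fix g
    have "(\<Sum>j\<in>{..<card Z}. poly.coeff Q j * (if g \<in> Z then \<mu> g ^ (s + j) else 0))
        = (if g \<in> Z then \<mu> g ^ s * poly Q (\<mu> g) else 0)"
      by (simp add: Q power_add sum_distrib_left mult_ac)
    also have "\<dots> = (if g = \<one>\<^bsub>G\<^esub> then poly Q 1 else 0)"
      using zero one Z(2) by auto
    finally show "(\<Sum>j\<in>{..<card Z}. poly.coeff Q j * (if g \<in> Z then \<mu> g ^ (s + j) else 0))
        = (if g = \<one>\<^bsub>G\<^esub> then poly Q 1 else 0)" .
  qed
  also have "\<dots> = poly Q 1 \<odot>\<^bsub>M\<^esub> w"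
    by (rule gsum_delta[OF w(1)])
  finally have "inverse (poly Q 1) \<odot>\<^bsub>M\<^esub> (poly Q 1 \<odot>\<^bsub>M\<^esub> w) = \<zero>\<^bsub>M\<^esub>"
    using smult_r_null by simp
  then show False
    using nz w by (simp add: smult_1 flip: smult_mult)
qed

end

section \<open>Evaluation along the orbit of a linear functional\<close>

text \<open>
  A linear functional on \<open>V\<close> is given by its values \<open>\<alpha> i\<close> on the basis, and
  \<open>orbit_point \<alpha> g\<close> is the functional \<open>\<alpha> \<circ> g\<close>.
\<close>

context coord_rep
begin

definition orbit_point :: "('n \<Rightarrow> 'f) \<Rightarrow> 'g \<Rightarrow> 'n \<Rightarrow> 'f" where
  "orbit_point \<alpha> g i = (\<Sum>j\<in>UNIV. \<alpha> j * \<rho> g (axis i 1) $ j)"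

lemma orbit_point_linear:
  assumes "g \<in> carrier G"
  shows "(\<Sum>j\<in>UNIV. \<alpha> j * \<rho> g v $ j) = (\<Sum>i\<in>UNIV. v $ i * orbit_point \<alpha> g i)"
proof -
  have "(\<Sum>j\<in>UNIV. \<alpha> j * \<rho> g v $ j)
      = (\<Sum>j\<in>UNIV. \<Sum>i\<in>UNIV. v $ i * (\<alpha> j * \<rho> g (axis i 1) $ j))"
    by (subst rep_expand[OF assms]) (simp add: sum_distrib_left mult.left_commute)
  also have "\<dots> = (\<Sum>i\<in>UNIV. v $ i * orbit_point \<alpha> g i)"
    by (subst sum.swap) (simp add: orbit_point_def sum_distrib_left)
  finally show ?thesis .
qed

lemma orbit_point_scalar:
  assumes "\<And>v. \<rho> g v = c *s v"
  shows "orbit_point \<alpha> g = (\<lambda>i. c * \<alpha> i)"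
  by (simp add: fun_eq_iff orbit_point_def assms axis_def if_distrib[of "\<lambda>x. _ * x"] cong: if_cong)

lemma orbit_point_one: "orbit_point \<alpha> \<one>\<^bsub>G\<^esub> = \<alpha>"
  using orbit_point_scalar[of "\<one>\<^bsub>G\<^esub>" 1] by (simp add: rep_one)

text \<open>The polynomial h p is p with each variable replaced by its image under h, and \<alpha>
  \<circ> g takes that image to the value of \<alpha> \<circ> gh. The action therefore becomes right
  translation of orbit points.\<close>

lemma poly_eval_poly_act:
  assumes "g \<in> carrier G" "h \<in> carrier G"
  shows "poly_eval (\<lambda>c. c) (orbit_point \<alpha> g) (poly_act \<rho> h p)
    = poly_eval (\<lambda>c. c) (orbit_point \<alpha> (g \<otimes>\<^bsub>G\<^esub> h)) p"
proof -
  have "orbit_point \<alpha> (g \<otimes>\<^bsub>G\<^esub> h) = (\<lambda>i. poly_eval (\<lambda>c. c) (orbit_point \<alpha> g)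
      (linear_form (\<rho> h (axis i 1))))"
    by (simp add: fun_eq_iff id.poly_eval_linear_form rep_mult[OF assms]
        flip: orbit_point_linear[OF assms(1)]) (simp add: orbit_point_def rep_mult[OF assms])
  then show ?thesis
    by (simp add: poly_act_def id.poly_eval_msubst)
qed

end

section \<open>A generic linear functional\<close>

text \<open>For nonconstant p, a root of p - 1 is a point where p takes the value 1; this uses
  algebraic closedness directly.\<close>

lemma exists_nonroot:
  fixes p :: "'f::alg_closed_field poly"
  assumes "p \<noteq> 0"
  shows "\<exists>t. poly p t \<noteq> 0"
proof (cases "Polynomial.degree p = 0")
  case True
  then show ?thesis
    using assms by (auto elim!: degree_eq_zeroE)
next
  case False
  have "Polynomial.degree (p + [:- 1:]) = Polynomial.degree p"
    using False by (intro degree_add_eq_left) simp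
  then obtain t where "poly (p + [:- 1:]) t = 0"
    using False alg_closed_imp_poly_has_root by (metis neq0_conv)
  then show ?thesis
    by (intro exI[of _ t]) auto
qed

text \<open>
  On the moment curve \<open>\<alpha> j = t ^ e j\<close> with \<open>e i0 = 0\<close>, proportionality of \<open>\<alpha> \<circ> g\<close> and \<open>\<alpha>\<close>
  is a system of polynomial equations in \<open>t\<close>; by comparison of degrees it is trivial only if \<open>g\<close>
  is scalar.
\<close>

lemma exists_generic_functional:
  fixes \<rho> :: "'g \<Rightarrow> 'f::alg_closed_field ^ 'n::finite \<Rightarrow> 'f ^ 'n"
  assumes "coord_rep G \<rho>" "finite (carrier G)"
  shows "\<exists>\<alpha> i0. \<alpha> i0 = 1 \<and> (\<forall>g\<in>carrier G. (\<nexists>c. \<forall>v. \<rho> g v = c *s v) \<longrightarrow>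
    (\<exists>i. coord_rep.orbit_point \<rho> \<alpha> g i \<noteq> coord_rep.orbit_point \<rho> \<alpha> g i0 * \<alpha> i))"
proof -
  interpret coord_rep G \<rho>
    by fact
  obtain e :: "'n \<Rightarrow> nat" where e: "bij_betw e UNIV {0..<CARD('n)}"
    using ex_bij_betw_finite_nat[of "UNIV :: 'n set"] by auto
  have "0 \<in> {0..<CARD('n)}" "CARD('n) - 1 \<in> {0..<CARD('n)}"
    by auto
  then obtain i0 i1 where i0: "e i0 = 0" and i1: "e i1 = CARD('n) - 1"
    using e by (metis bij_betw_imp_surj_on imageE)
  have inj: "e i = e j \<longleftrightarrow> i = j" for i j
    using e by (auto simp: bij_betw_def inj_on_def)
  have e_le: "e i \<le> CARD('n) - 1" for i
    using bij_betwE[OF e] by (simp add: Suc_leI le_diff_conv2)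
  \<comment> \<open>On the moment curve \<open>B g k\<close> is \<alpha>(g x_k) as a polynomial in
    t. As \<open>\<alpha> i0 = 1\<close>, the only possible factor of proportionality is
    \<open>B g i0\<close>, and \<open>P g i\<close> measures its failure at i.\<close>
  define B where "B g k = (\<Sum>j\<in>UNIV. Polynomial.monom (\<rho> g (axis k 1) $ j) (e j))" for g k
  define P where "P g i = B g i - B g i0 * Polynomial.monom 1 (e i)" for g i
  have deg: "Polynomial.degree (B g k) \<le> CARD('n) - 1" for g k
    unfolding B_def by (rule degree_sum_le) (simp, rule order.trans[OF degree_monom_le e_le])
  have coeff: "poly.coeff (B g k) (e j) = \<rho> g (axis k 1) $ j" for g k j
    by (simp add: B_def coeff_sum inj)
  have scalar: "\<exists>c. \<forall>v. \<rho> g v = c *s v" if g: "g \<in> carrier G" and P: "\<And>i. P g i = 0" for g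
  proof -
    have B: "B g i = B g i0 * Polynomial.monom 1 (e i)" for i
      using P[of i] by (simp add: P_def)
    \<comment> \<open>The exponent of i1 is the largest one, so a nonconstant \<open>B g i0\<close>
      would push \<open>B g i1\<close> above the degree bound.\<close>
    have "Polynomial.degree (B g i0) = 0"
    proof (cases "B g i0 = 0")
      case False
      then have "Polynomial.degree (B g i1) = Polynomial.degree (B g i0) + (CARD('n) - 1)"
        by (subst B) (simp add: degree_mult_eq degree_monom_eq monom_eq_0_iff i1)
      then show ?thesis
        using deg[of g i1] by linarith
    qed simp
    then obtain c where c: "B g i0 = [:c:]"
      by (auto elim: degree_eq_zeroE)
    have "B g i = Polynomial.monom c (e i)" for i
      by (subst B) (simp add: c smult_monom)
    then have "\<rho> g (axis i 1) $ j = (if i = j then c else 0)" for i j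
      using coeff[of g i j] by (simp add: inj)
    then have "\<rho> g v = c *s v" for v
      by (subst rep_expand[OF g]) (simp add: vec_eq_iff if_distrib[of "\<lambda>x. _ * x"] cong: if_cong)
    then show ?thesis
      by blast
  qed
  define H where "H = {g \<in> carrier G. \<nexists>c. \<forall>v. \<rho> g v = c *s v}"
  have "\<forall>g\<in>H. \<exists>i. P g i \<noteq> 0"
    using scalar unfolding H_def by blast
  then obtain k where k: "\<And>g. g \<in> H \<Longrightarrow> P g (k g) \<noteq> 0"
    by metis
  \<comment> \<open>A single t must serve all non-scalar g at once: it is a non-root of the product
    of one nonzero polynomial for each.\<close>
  have "finite H"
    using assms(2) by (simp add: H_def)
  then have "(\<Prod>g\<in>H. P g (k g)) \<noteq> 0"
    using k by simp
  then obtain t where "poly (\<Prod>g\<in>H. P g (k g)) t \<noteq> 0"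
    using exists_nonroot by blast
  then have t: "poly (P g (k g)) t \<noteq> 0" if "g \<in> H" for g
    using that \<open>finite H\<close> by (simp add: poly_prod)
  define \<alpha> where "\<alpha> j = t ^ e j" for j
  have "poly (B g i) t = orbit_point \<alpha> g i" for g i
    by (simp add: B_def \<alpha>_def orbit_point_def poly_sum poly_monom mult.commute)
  then have "poly (P g i) t = orbit_point \<alpha> g i - orbit_point \<alpha> g i0 * \<alpha> i" for g i
    by (simp add: P_def \<alpha>_def poly_monom)
  moreover have "\<alpha> i0 = 1"
    by (simp add: \<alpha>_def i0)
  ultimately show ?thesis
    using t by (intro exI[of _ \<alpha>] exI[of _ i0]) (auto simp: H_def)
qed

section \<open>The elements acting as scalars and the separating form\<close>

locale generic_rep = coord_rep G \<rho>
  for G :: "('g, 'r) monoid_scheme" and \<rho> :: "'g \<Rightarrow> 'f::field ^ 'n::finite \<Rightarrow> 'f ^ 'n" +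
  fixes \<alpha> :: "'n \<Rightarrow> 'f" and i0 :: 'n
  assumes finite_G: "finite (carrier G)"
    and faithful: "FG_faithful G (coord_module \<rho>)"
    and \<alpha>_i0: "\<alpha> i0 = 1"
    and generic: "\<And>g. g \<in> carrier G \<Longrightarrow> \<nexists>c. \<forall>v. \<rho> g v = c *s v \<Longrightarrow>
      \<exists>i. orbit_point \<alpha> g i \<noteq> orbit_point \<alpha> g i0 * \<alpha> i"
begin

text \<open>The inverse does not change the set; it matches \<psi>, which evaluates at \<alpha>
  \<circ> g^-1.\<close>

definition Z :: "'g set" where
  "Z = {g \<in> carrier G. \<exists>c. \<forall>v. \<rho> (inv\<^bsub>G\<^esub> g) v = c *s v}"

text \<open>For g in Z this is the scalar by which the inverse of g acts, read off at the coordinate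
  where \<alpha> is 1.\<close>

definition \<mu> :: "'g \<Rightarrow> 'f" where
  "\<mu> g = orbit_point \<alpha> (inv\<^bsub>G\<^esub> g) i0"

lemma Z_subset: "Z \<subseteq> carrier G"
  by (auto simp: Z_def)

lemma rep_Z:
  assumes "g \<in> Z"
  shows "\<rho> (inv\<^bsub>G\<^esub> g) v = \<mu> g *s v"
proof -
  obtain c where "\<And>v. \<rho> (inv\<^bsub>G\<^esub> g) v = c *s v"
    using assms by (auto simp: Z_def)
  moreover from this have "\<mu> g = c"
    using orbit_point_scalar[of "inv\<^bsub>G\<^esub> g" c \<alpha>] by (simp add: \<mu>_def \<alpha>_i0)
  ultimately show ?thesis
    by simp
qed

lemma one_in_Z: "\<one>\<^bsub>G\<^esub> \<in> Z"
  unfolding Z_def by (auto simp: rep_one intro!: exI[of _ 1])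

lemma \<mu>_one: "\<mu> \<one>\<^bsub>G\<^esub> = 1"
  by (simp add: \<mu>_def orbit_point_one \<alpha>_i0)

lemma inj_on_\<mu>: "inj_on \<mu> Z"
proof (rule inj_onI)
  fix g h assume gh: "g \<in> Z" "h \<in> Z" "\<mu> g = \<mu> h"
  then have "\<rho> (inv\<^bsub>G\<^esub> g) = \<rho> (inv\<^bsub>G\<^esub> h)"
    by (simp add: fun_eq_iff rep_Z)
  moreover have "g \<in> carrier G" "h \<in> carrier G"
    using gh Z_subset by auto
  ultimately have "inv\<^bsub>G\<^esub> g = inv\<^bsub>G\<^esub> h"
    using faithful by (simp add: FG_faithful_def inj_on_def)
  then show "g = h"
    using \<open>g \<in> carrier G\<close> \<open>h \<in> carrier G\<close> by (metis V.inv_inv)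
qed

text \<open>An element of G raised to the group order is the identity, so the corresponding power of
  its scalar is 1.\<close>

lemma \<mu>_power_order:
  assumes "g \<in> Z"
  shows "\<mu> g ^ order G = 1"
proof -
  have g: "inv\<^bsub>G\<^esub> g \<in> carrier G"
    using assms Z_subset by auto
  have "\<rho> (inv\<^bsub>G\<^esub> g [^]\<^bsub>G\<^esub> k) v = \<mu> g ^ k *s v" for k :: nat and v
    by (induction k arbitrary: v) (simp_all add: rep_one rep_mult g rep_Z assms vector_smult_assoc mult.commute)
  from this[of "order G" "axis i0 1"] have "axis i0 1 $ i0 = (\<mu> g ^ order G *s axis i0 1) $ i0"
    by (simp add: V.pow_order_eq_1[OF g] rep_one)
  then show ?thesis
    by (simp add: axis_def)
qed

text \<open>Each g outside Z contributes one linear factor that vanishes at its orbit point and is 1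
  at \<alpha>. Powers of x_i0, also 1 at \<alpha>, fill up the degree. On Z the orbit points are
  \<open>\<mu> g\<close> times \<alpha>, and homogeneity gives the value.\<close>

lemma exists_separating_form:
  assumes "card (carrier G - Z) \<le> m"
  shows "\<exists>h. homogeneous m h \<and> (\<forall>g\<in>carrier G.
    poly_eval (\<lambda>c. c) (orbit_point \<alpha> (inv\<^bsub>G\<^esub> g)) h = (if g \<in> Z then \<mu> g ^ m else 0))"
proof -
  let ?ev = "poly_eval (\<lambda>c::'f. c)"
  have "\<exists>l. homogeneous 1 l \<and> ?ev \<alpha> l = 1 \<and> ?ev (orbit_point \<alpha> (inv\<^bsub>G\<^esub> g)) l = 0"
    if g: "g \<in> carrier G - Z" for g
  proof -
    let ?a = "orbit_point \<alpha> (inv\<^bsub>G\<^esub> g)"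
    obtain i where i: "?a i \<noteq> ?a i0 * \<alpha> i"
      using generic[of "inv\<^bsub>G\<^esub> g"] g by (auto simp: Z_def)
    \<comment> \<open>With a the orbit point, the form is (a_i0 x_i - a_i x_i0) / d. It vanishes at
      a, and d is the value of the numerator at \<alpha>, nonzero by genericity.\<close>
    define d where "d = ?a i0 * \<alpha> i - ?a i"
    let ?l = "mconst (?a i0 / d) * mvar i + mconst (- ?a i / d) * mvar i0"
    have "homogeneous 1 ?l"
      by (intro homogeneous_add homogeneous_mconst_mult homogeneous_mvar)
    moreover have "?ev \<alpha> ?l = d / d"
      using diff_divide_distrib[of "?a i0 * \<alpha> i" "?a i" d]
      by (simp add: id.poly_eval_add id.poly_eval_mult \<alpha>_i0 flip: d_def)
    moreover have "?ev ?a ?l = 0"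
      by (simp add: id.poly_eval_add id.poly_eval_mult mult.commute)
    moreover have "d \<noteq> 0"
      using i by (simp add: d_def)
    ultimately show ?thesis
      by (metis divide_self)
  qed
  then obtain l where l: "\<And>g. g \<in> carrier G - Z \<Longrightarrow> homogeneous 1 (l g)"
      "\<And>g. g \<in> carrier G - Z \<Longrightarrow> ?ev \<alpha> (l g) = 1"
      "\<And>g. g \<in> carrier G - Z \<Longrightarrow> ?ev (orbit_point \<alpha> (inv\<^bsub>G\<^esub> g)) (l g) = 0"
    by metis
  define h where "h = (\<Prod>g\<in>carrier G - Z. l g) * mvar i0 ^ (m - card (carrier G - Z))"
  have "homogeneous ((\<Sum>g\<in>carrier G - Z. 1) + (m - card (carrier G - Z)) * 1) h"
    unfolding h_def by (intro homogeneous_mult homogeneous_prod homogeneous_power homogeneous_mvar l(1))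
  then have h: "homogeneous m h"
    using assms by simp
  have \<alpha>_h: "?ev \<alpha> h = 1"
    by (simp add: h_def id.poly_eval_mult id.poly_eval_prod id.poly_eval_power l(2) \<alpha>_i0)
  have "?ev (orbit_point \<alpha> (inv\<^bsub>G\<^esub> g)) h = (if g \<in> Z then \<mu> g ^ m else 0)" if "g \<in> carrier G" for g
  proof (cases "g \<in> Z")
    case True
    then show ?thesis
      by (simp add: orbit_point_scalar[OF rep_Z] poly_eval_scale[OF h] \<alpha>_h)
  next
    case False
    then have "?ev (orbit_point \<alpha> (inv\<^bsub>G\<^esub> g)) (\<Prod>g\<in>carrier G - Z. l g) = 0"
      unfolding id.poly_eval_prod using that l(3) finite_G by (intro prod_zero) auto
    then show ?thesis
      using False by (simp add: h_def id.poly_eval_mult)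
  qed
  with h show ?thesis
    by blast
qed

end

section \<open>Embedding irreducible modules and projecting onto them\<close>

context coord_rep
begin

text \<open>A functional is built on the space of all polynomials so that it kills the kernel of
  \<psi>, and then descends along the surjection \<psi> to W.\<close>

lemma exists_functional:
  fixes W :: "('f, 'w, 'g) gmodule"
  assumes "FG_module_hom G (Sym_power m \<rho>) W \<psi>"
    and surj: "\<psi> ` carrier (Sym_power m \<rho>) = carrier W"
    and a: "homogeneous m a" "\<psi> a \<noteq> \<zero>\<^bsub>W\<^esub>"
  shows "\<exists>\<theta>. (\<forall>x\<in>carrier W. \<forall>y\<in>carrier W. \<theta> (x \<oplus>\<^bsub>W\<^esub> y) = \<theta> x + \<theta> y) \<and>
    (\<forall>c. \<forall>x\<in>carrier W. \<theta> (c \<odot>\<^bsub>W\<^esub> x) = c * \<theta> x) \<and> \<theta> (\<psi> a) = (1 :: 'f)"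
proof -
  interpret \<psi>: FG_module_hom G "Sym_power m \<rho>" W \<psi>
    by fact
  let ?scale = "\<lambda>c (p :: ('n, 'f) mpoly). mconst c * p"
  interpret vector_space_pair ?scale "(*) :: 'f \<Rightarrow> 'f \<Rightarrow> 'f"
    by unfold_locales (simp_all add: mconst.add mconst.mult mconst.one ring_distribs mult.assoc)
  have ker: "vs1.subspace \<psi>.ker"
    using \<psi>.hom_zero by (auto simp: vs1.subspace_def \<psi>.ker_def homogeneous_add homogeneous_mconst_mult
        \<psi>.hom_add[simplified] \<psi>.hom_smult[simplified])
  \<comment> \<open>A basis of the kernel. It stays independent with a added since
    \<open>\<psi> a\<close> is nonzero, so L may be prescribed as 0 on B and 1 at a.\<close>
  obtain B where B: "B \<subseteq> \<psi>.ker" "vs1.independent B" "\<psi>.ker \<subseteq> vs1.span B"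
    using vs1.maximal_independent_subset[of \<psi>.ker] by blast
  have "a \<notin> vs1.span B"
    using vs1.span_minimal[OF B(1) ker] a by (auto simp: \<psi>.ker_def)
  then have "vs1.independent (insert a B)" "a \<notin> B"
    using vs1.independent_insertI[OF _ B(2)] vs1.span_base by blast+
  then obtain L where L: "Vector_Spaces.linear ?scale (*) L"
      "\<And>x. x \<in> insert a B \<Longrightarrow> L x = (if x = a then 1 else 0)"
    using linear_independent_extend[of "insert a B" "\<lambda>x. if x = a then 1 else 0"] by blast
  interpret L: Vector_Spaces.linear ?scale "(*)" L
    by fact
  have L_ker: "L x = 0" if "x \<in> \<psi>.ker" for x
  proof (rule linear_eq_0_on_span[OF L(1)])
    show "L b = 0" if "b \<in> B" for b
      using that L(2)[of b] \<open>a \<notin> B\<close> by auto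
    show "x \<in> vs1.span B"
      using that B(3) by auto
  qed
  \<comment> \<open>The chosen preimage is immaterial: two preimages differ by an element of the
    kernel, where L vanishes.\<close>
  define \<theta> where "\<theta> u = L (inv_into {p. homogeneous m p} \<psi> u)" for u
  have \<theta>: "\<theta> (\<psi> p) = L p" if p: "homogeneous m p" for p
  proof -
    let ?q = "inv_into {p. homogeneous m p} \<psi> (\<psi> p)"
    let ?d = "?q \<oplus>\<^bsub>Sym_power m \<rho>\<^esub> \<ominus>\<^bsub>Sym_power m \<rho>\<^esub> p"
    have q: "homogeneous m ?q" "\<psi> ?q = \<psi> p"
      using p inv_into_into[of "\<psi> p" \<psi> "{p. homogeneous m p}"]
        f_inv_into_f[of "\<psi> p" \<psi> "{p. homogeneous m p}"] by auto
    then have "?d \<in> \<psi>.ker"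
      using p by (intro \<psi>.diff_in_ker) auto
    moreover have "p \<in> carrier (Sym_power m \<rho>)" "?q \<in> carrier (Sym_power m \<rho>)"
      using p q by auto
    then have "?d \<oplus>\<^bsub>Sym_power m \<rho>\<^esub> p = ?q"
      by (simp only: \<psi>.M.M.a_assoc \<psi>.M.M.a_inv_closed \<psi>.M.M.l_neg \<psi>.M.M.r_zero)
    then have "L ?q = L ?d + L p"
      using L.add[of ?d p] by (simp only: Sym_power_simps(2))
    ultimately show ?thesis
      using L_ker[of ?d] by (simp add: \<theta>_def)
  qed
  have W: "\<exists>p. homogeneous m p \<and> u = \<psi> p" if "u \<in> carrier W" for u
    using that surj by auto
  have "\<theta> (x \<oplus>\<^bsub>W\<^esub> y) = \<theta> x + \<theta> y" if xy: "x \<in> carrier W" "y \<in> carrier W" for x y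
  proof -
    obtain p q where p: "homogeneous m p" "x = \<psi> p" and q: "homogeneous m q" "y = \<psi> q"
      using W[OF xy(1)] W[OF xy(2)] by auto
    have "\<theta> (x \<oplus>\<^bsub>W\<^esub> y) = \<theta> (\<psi> (p + q))"
      using \<psi>.hom_add[of p q] p q by simp
    also have "\<dots> = L (p + q)"
      by (intro \<theta> homogeneous_add p q)
    finally show ?thesis
      by (simp only: L.add p q \<theta>)
  qed
  moreover have "\<theta> (c \<odot>\<^bsub>W\<^esub> x) = c * \<theta> x" if x: "x \<in> carrier W" for c x
  proof -
    obtain p where p: "homogeneous m p" "x = \<psi> p"
      using W[OF x] by auto
    have "\<theta> (c \<odot>\<^bsub>W\<^esub> x) = \<theta> (\<psi> (mconst c * p))"
      using \<psi>.hom_smult[of p c] p by simp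
    also have "\<dots> = L (mconst c * p)"
      by (intro \<theta> homogeneous_mconst_mult p)
    finally show ?thesis
      by (simp only: L.scale p \<theta>)
  qed
  moreover have "\<theta> (\<psi> a) = 1"
    using \<theta>[OF a(1)] L(2)[of a] by simp
  ultimately show ?thesis
    by blast
qed

end

text \<open>The hypothesis says \<open>\<psi> h \<noteq> 0\<close>. It makes \<psi> surjective,
  which gives the quotient, and through \<open>\<theta> (\<psi> h) = 1\<close> it also certifies
  \<open>\<Phi> w \<noteq> 0\<close>, which gives the embedding.\<close>

lemma (in generic_rep) irreducible_in_Sym_power:
  fixes W :: "('f, 'w, 'g) gmodule"
  assumes W: "FG_module G W" "FG_irreducible G W" and w: "w \<in> carrier W"
    and h: "homogeneous m h"
    and nz: "finite_FG_module.gsum G W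
      (\<lambda>g. poly_eval (\<lambda>c. c) (orbit_point \<alpha> (inv\<^bsub>G\<^esub> g)) h) w \<noteq> \<zero>\<^bsub>W\<^esub>"
  shows "\<exists>N. FG_submodule N G (Sym_power m \<rho>) \<and>
      FG_isomorphic G W ((Sym_power m \<rho>)\<lparr>carrier := N\<rparr>)"
    and "\<exists>N. FG_submodule N G (Sym_power m \<rho>) \<and>
      FG_isomorphic G W (FG_quotient (Sym_power m \<rho>) N)"
proof -
  interpret W: finite_FG_module G W
    using W(1) finite_G by (simp add: finite_FG_module_def finite_FG_module_axioms_def)
  let ?S = "Sym_power m \<rho>"
  let ?ev = "\<lambda>g. poly_eval (\<lambda>c::'f. c) (orbit_point \<alpha> g)"
  define \<psi> where "\<psi> p = W.gsum (\<lambda>g. ?ev (inv\<^bsub>G\<^esub> g) p) w" for p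
  \<comment> \<open>Acting by x moves the evaluation point from g^-1 to g^-1 x = (x^-1 g)^-1, the
    same translation as in \<open>act_gsum\<close>.\<close>
  have "\<psi> (poly_act \<rho> x p) = act W x (\<psi> p)" if "x \<in> carrier G" for x p
    unfolding \<psi>_def W.act_gsum[OF that w]
    by (rule W.gsum_cong[OF w])
      (simp add: that poly_eval_poly_act V.inv_mult_group)
  then have "\<psi> \<in> FG_hom G ?S W"
    by (auto simp: FG_hom_def \<psi>_def w W.gsum_closed W.gsum_add W.gsum_smult
        id.poly_eval_add id.poly_eval_mult)
  then have \<psi>: "FG_module_hom G ?S W \<psi>"
    using Sym_power_FG_module[of m] W(1)
    by (simp add: FG_module_hom_def FG_module_hom_axioms_def)
  interpret \<psi>: FG_module_hom G ?S W \<psi>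
    by (fact \<psi>)
  have \<psi>_h: "\<psi> h \<noteq> \<zero>\<^bsub>W\<^esub>"
    using nz by (simp add: \<psi>_def)
  have surj: "\<psi> ` carrier ?S = carrier W"
    using h \<psi>_h by (intro \<psi>.surj[OF W(2), of h]) auto
  show "\<exists>N. FG_submodule N G ?S \<and> FG_isomorphic G W (FG_quotient ?S N)"
    using \<psi>.ker_submodule \<psi>.isomorphic_quotient[OF surj] by blast
  obtain \<theta> :: "'w \<Rightarrow> 'f" where
    \<theta>_add: "\<And>x y. x \<in> carrier W \<Longrightarrow> y \<in> carrier W \<Longrightarrow> \<theta> (x \<oplus>\<^bsub>W\<^esub> y) = \<theta> x + \<theta> y" and
    \<theta>_smult: "\<And>c x. x \<in> carrier W \<Longrightarrow> \<theta> (c \<odot>\<^bsub>W\<^esub> x) = c * \<theta> x" and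
    \<theta>_h: "\<theta> (\<psi> h) = 1"
    using exists_functional[OF \<psi> surj h \<psi>_h] by blast
  define \<Phi> where "\<Phi> u = (\<Sum>g\<in>carrier G. mconst (\<theta> (act W (inv\<^bsub>G\<^esub> g) u)) * poly_act \<rho> g h)" for u
  have "\<Phi> (act W x u) = poly_act \<rho> x (\<Phi> u)" if x: "x \<in> carrier G" and u: "u \<in> carrier W" for x u
  proof -
    have "\<Phi> (act W x u) = (\<Sum>g\<in>carrier G.
        mconst (\<theta> (act W (inv\<^bsub>G\<^esub> (x \<otimes>\<^bsub>G\<^esub> g)) (act W x u))) * poly_act \<rho> (x \<otimes>\<^bsub>G\<^esub> g) h)"
      \<comment> \<open>Replacing g by xg cancels x inside \<theta> and lets it act on the
        translates of h instead.\<close>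
      unfolding \<Phi>_def by (rule sum.reindex_bij_betw[OF W.bij_betw_mult_left[OF x], symmetric])
    also have "\<dots> = (\<Sum>g\<in>carrier G.
        mconst (\<theta> (act W (inv\<^bsub>G\<^esub> g) u)) * poly_act \<rho> x (poly_act \<rho> g h))"
    proof (rule sum.cong[OF refl])
      fix g assume g: "g \<in> carrier G"
      have "act W (inv\<^bsub>G\<^esub> (x \<otimes>\<^bsub>G\<^esub> g)) (act W x u) = act W (inv\<^bsub>G\<^esub> g) u"
        using x g u by (simp add: V.inv_mult_cancel flip: W.act_mult)
      then show "mconst (\<theta> (act W (inv\<^bsub>G\<^esub> (x \<otimes>\<^bsub>G\<^esub> g)) (act W x u))) * poly_act \<rho> (x \<otimes>\<^bsub>G\<^esub> g) h
          = mconst (\<theta> (act W (inv\<^bsub>G\<^esub> g) u)) * poly_act \<rho> x (poly_act \<rho> g h)"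
        by (simp add: poly_act_mult x g)
    qed
    also have "\<dots> = poly_act \<rho> x (\<Phi> u)"
      by (simp add: \<Phi>_def poly_act_eq_poly_eval mconst.poly_eval_sum mconst.poly_eval_mult)
    finally show ?thesis .
  qed
  then have "\<Phi> \<in> FG_hom G W ?S"
    by (auto simp: FG_hom_def \<Phi>_def h homogeneous_sum homogeneous_mconst_mult homogeneous_poly_act
        W.act_closed W.act_add W.act_smult \<theta>_add \<theta>_smult mconst.add mconst.mult ring_distribs
        sum.distrib sum_distrib_left mult.assoc)
  then interpret \<Phi>: FG_module_hom G W ?S \<Phi>
    using Sym_power_FG_module[of m] W(1)
    by (simp add: FG_module_hom_def FG_module_hom_axioms_def)
  \<comment> \<open>Evaluation at \<alpha> itself, the orbit point of the identity. After g is
    replaced by its inverse, the sum is \<theta> applied to \<open>\<psi> h\<close>.\<close>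
  have "?ev \<one>\<^bsub>G\<^esub> (\<Phi> w) = (\<Sum>g\<in>carrier G. \<theta> (act W (inv\<^bsub>G\<^esub> g) w) * ?ev g h)"
    by (simp add: \<Phi>_def id.poly_eval_sum id.poly_eval_mult poly_eval_poly_act)
  also have "\<dots> = (\<Sum>g\<in>carrier G. \<theta> (act W (inv\<^bsub>G\<^esub> (inv\<^bsub>G\<^esub> g)) w) * ?ev (inv\<^bsub>G\<^esub> g) h)"
  proof (rule sum.reindex_bij_betw[symmetric])
    show "bij_betw (\<lambda>g. inv\<^bsub>G\<^esub> g) (carrier G) (carrier G)"
      by (rule bij_betw_byWitness[where f' = "\<lambda>g. inv\<^bsub>G\<^esub> g"]) auto
  qed
  also have "\<dots> = (\<Sum>g\<in>carrier G. ?ev (inv\<^bsub>G\<^esub> g) h * \<theta> (act W g w))"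
    by (simp add: mult.commute)
  also have "\<dots> = \<theta> (\<psi> h)"
    unfolding \<psi>_def by (rule W.functional_gsum[symmetric]) (fact \<theta>_add \<theta>_smult w)+
  finally have "\<Phi> w \<noteq> \<zero>\<^bsub>?S\<^esub>"
    using \<theta>_h by auto
  then show "\<exists>N. FG_submodule N G ?S \<and> FG_isomorphic G W (?S\<lparr>carrier := N\<rparr>)"
    using \<Phi>.image_submodule \<Phi>.isomorphic_image[OF W(2) w] by blast
qed

section \<open>Choice of the degree\<close>

theorem theorem1:
  fixes G :: "('g, 'r) monoid_scheme"
    and \<rho> :: "'g \<Rightarrow> ('f::alg_closed_field) ^ ('n::finite) \<Rightarrow> 'f ^ 'n"
    and W :: "('f, 'w, 'g) gmodule"
  assumes "group G" and "finite (carrier G)"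
    and "FG_module G (coord_module \<rho>)" and "FG_faithful G (coord_module \<rho>)"
    and "FG_module G W" and "FG_irreducible G W"
  shows "\<exists>m. 1 \<le> m \<and> m \<le> order G \<and>
    (\<exists>N. FG_submodule N G (Sym_power m \<rho>) \<and>
         FG_isomorphic G W ((Sym_power m \<rho>)\<lparr>carrier := N\<rparr>)) \<and>
    (\<forall>k. \<exists>N. FG_submodule N G (Sym_power (m + k * order G) \<rho>) \<and>
         FG_isomorphic G W ((Sym_power (m + k * order G) \<rho>)\<lparr>carrier := N\<rparr>)) \<and>
    (\<forall>k. \<exists>N. FG_submodule N G (Sym_power (m + k * order G) \<rho>) \<and>
         FG_isomorphic G W (FG_quotient (Sym_power (m + k * order G) \<rho>) N))"
proof -
  have rep: "coord_rep G \<rho>"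
    using assms(3) by (simp add: coord_rep_def)
  obtain \<alpha> i0 where "\<alpha> i0 = 1" "\<forall>g\<in>carrier G. (\<nexists>c. \<forall>v. \<rho> g v = c *s v) \<longrightarrow>
      (\<exists>i. coord_rep.orbit_point \<rho> \<alpha> g i \<noteq> coord_rep.orbit_point \<rho> \<alpha> g i0 * \<alpha> i)"
    using exists_generic_functional[OF rep assms(2)] by blast
  then interpret generic_rep G \<rho> \<alpha> i0
    using rep assms(2,4) by (simp add: generic_rep_def generic_rep_axioms_def)
  interpret W: finite_FG_module G W
    using assms(2,5) by (simp add: finite_FG_module_def finite_FG_module_axioms_def)
  obtain w where w: "w \<in> carrier W" "w \<noteq> \<zero>\<^bsub>W\<^esub>"
    using assms(6) W.M.zero_closed by (auto simp: FG_irreducible_def)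
  have Z: "card Z \<le> order G" "card (carrier G - Z) = order G - card Z" "card Z \<noteq> 0"
    using Z_subset finite_G one_in_Z finite_subset[OF Z_subset]
    by (auto simp: Coset.order_def card_mono card_Diff_subset)
  \<comment> \<open>For j below \<open>card Z\<close>, s + j runs through the last
    \<open>card Z\<close> integers up to |G|. The summand 1 ensures m \<ge> 1 even when Z is all of
    G, and m stays large enough for a separating form.\<close>
  define s where "s = order G - card Z + 1"
  obtain j where j: "j < card Z"
      "W.gsum (\<lambda>g. if g \<in> Z then \<mu> g ^ (s + j) else 0) w \<noteq> \<zero>\<^bsub>W\<^esub>"
    using W.exists_weighted_sum_nonzero[OF Z_subset one_in_Z inj_on_\<mu> \<mu>_one w] by blast
  define m where "m = s + j"
  have main: "(\<exists>N. FG_submodule N G (Sym_power (m + k * order G) \<rho>) \<and>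
         FG_isomorphic G W ((Sym_power (m + k * order G) \<rho>)\<lparr>carrier := N\<rparr>)) \<and>
      (\<exists>N. FG_submodule N G (Sym_power (m + k * order G) \<rho>) \<and>
         FG_isomorphic G W (FG_quotient (Sym_power (m + k * order G) \<rho>) N))" for k
  proof -
    have "card (carrier G - Z) \<le> m + k * order G"
      by (simp add: Z m_def s_def)
    then obtain h where h: "homogeneous (m + k * order G) h"
        "\<And>g. g \<in> carrier G \<Longrightarrow> poly_eval (\<lambda>c. c) (orbit_point \<alpha> (inv\<^bsub>G\<^esub> g)) h
          = (if g \<in> Z then \<mu> g ^ (m + k * order G) else 0)"
      using exists_separating_form by blast
    \<comment> \<open>Raising the degree by multiples of |G| leaves the weights on Z unchanged, so
      the nonvanishing found for m carries over to every k.\<close>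
    have "\<mu> g ^ (m + k * order G) = \<mu> g ^ m" if "g \<in> Z" for g
      using \<mu>_power_order[OF that] by (simp add: power_add power_mult mult.commute[of k])
    then have "W.gsum (\<lambda>g. poly_eval (\<lambda>c. c) (orbit_point \<alpha> (inv\<^bsub>G\<^esub> g)) h) w
        = W.gsum (\<lambda>g. if g \<in> Z then \<mu> g ^ m else 0) w"
      by (intro W.gsum_cong[OF w(1)]) (simp add: h(2))
    then have "W.gsum (\<lambda>g. poly_eval (\<lambda>c. c) (orbit_point \<alpha> (inv\<^bsub>G\<^esub> g)) h) w \<noteq> \<zero>\<^bsub>W\<^esub>"
      using j(2)[folded m_def] by simp
    from irreducible_in_Sym_power[OF assms(5,6) w(1) h(1) this] show ?thesis
      by blast
  qed
  have "1 \<le> m" "m \<le> order G"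
    using Z j(1) by (auto simp: m_def s_def)
  \<comment> \<open>The first statement is the case k = 0.\<close>
  moreover note main[of 0]
  ultimately show ?thesis
    using main by (intro exI[of _ m]) auto
qed

end
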